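(* Let $U=\begin{bmatrix} c_{RR} & c_{LR}\\ c_{RL} & c_{LL}\end{bmatrix}\in \mathrm{U}(2)$ with $c_{RR}\neq0$, let $\gamma,\delta\in\mathbb{R}$, and let $X_t^{(II)}$ be the Type II quantum walk with coin $U$, reflection phase $\gamma$ and initial state $\Psi_0^{(II)}=e^{i\delta}|0,L\rangle$. Put $b=\overline{c_{LR}}\,\Delta\, e^{-i\gamma}$, $\rho=\sqrt{1-|b|^2}$, $\nu^{(II)}(b)=\rho/|1+b|$ and $$M(b)=\bigl\{1+\mathrm{sgn}(|b|^2+\mathrm{Re}(b))\bigr\}\left|\frac{|b|^2+\mathrm{Re}(b)}{(1+b)^2}\right|.$$ Then for every $x\in\{0,1,2,\dots\}$, as $t\to\infty$, $$P(X_t^{(II)}=x)-\frac{1+(-1)^{x+t}}{2}\times\begin{cases}|M(b)|^2, & x=0,\\ |M(b)|^2\bigl(1+\nu^{(II)}(b)^{-2}\bigr)\,\nu^{(II)}(b)^{2x}, & x>0,\end{cases}\ \longrightarrow\ 0.$$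
   Context: For the coin $U$: $\Delta=\det U$; $\mathrm{sgn}(x)=1,0,-1$ for $x>0,x=0,x<0$. Type II quantum walk: the Hilbert space $\mathcal{H}^{(II)}$ has orthonormal basis $\{|0,L\rangle\}\cup\{|x,R\rangle,|x,L\rangle: x\ge1\}$; the unitary evolution $W^{(II,U)}$ is defined by $W|0,L\rangle=e^{i\gamma}|1,R\rangle$ and, for $x\ge1$, $W|x,R\rangle=c_{RR}|x+1,R\rangle+c_{LR}|x-1,L\rangle$, $W|x,L\rangle=c_{RL}|x+1,R\rangle+c_{LL}|x-1,L\rangle$ (with $|0,L\rangle$ as $|x-1,L\rangle$ when $x=1$). $P(X_t^{(II)}=x)=\sum_e|\langle e,(W^{(II,U)})^t\Psi_0^{(II)}\rangle|^2$, summed over basis vectors $e$ at position $x$ (only $|0,L\rangle$ for $x=0$; $|x,R\rangle,|x,L\rangle$ for $x\ge1$). *)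

theory Defs
  imports Complex_Main
begin

definition unitary2 :: "complex \<Rightarrow> complex \<Rightarrow> complex \<Rightarrow> complex \<Rightarrow> bool" where
  "unitary2 cRR cLR cRL cLL \<longleftrightarrow>
     cRR * cnj cRR + cLR * cnj cLR = 1 \<and>
     cRR * cnj cRL + cLR * cnj cLL = 0 \<and>
     cRL * cnj cRR + cLL * cnj cLR = 0 \<and>
     cRL * cnj cRL + cLL * cnj cLL = 1"

definition coin_det :: "complex \<Rightarrow> complex \<Rightarrow> complex \<Rightarrow> complex \<Rightarrow> complex" where
  "coin_det cRR cLR cRL cLL = cRR * cLL - cLR * cRL"

(* A state of the Type II walk: a pair (R, L) of amplitude functions;
   R x is the amplitude of |x,R> (x \<ge> 1; R 0 is unused and kept 0),
   L x is the amplitude of |x,L> (x \<ge> 0). *)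
type_synonym qstate2 = "(nat \<Rightarrow> complex) \<times> (nat \<Rightarrow> complex)"

(* One step of W^(II,U), computed amplitude-wise from the action on basis vectors. *)
definition walk2_step :: "complex \<Rightarrow> complex \<Rightarrow> complex \<Rightarrow> complex \<Rightarrow> real \<Rightarrow> qstate2 \<Rightarrow> qstate2" where
  "walk2_step cRR cLR cRL cLL \<gamma> \<psi> =
     ((\<lambda>y. if y = 0 then 0
           else if y = 1 then exp (\<i> * of_real \<gamma>) * snd \<psi> 0
           else cRR * fst \<psi> (y - 1) + cRL * snd \<psi> (y - 1)),
      (\<lambda>y. cLR * fst \<psi> (y + 1) + cLL * snd \<psi> (y + 1)))"

definition walk2_init :: "real \<Rightarrow> qstate2" where
  "walk2_init \<delta> = ((\<lambda>_. 0), (\<lambda>y. if y = 0 then exp (\<i> * of_real \<delta>) else 0))"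

definition walk2_prob :: "complex \<Rightarrow> complex \<Rightarrow> complex \<Rightarrow> complex \<Rightarrow> real \<Rightarrow> real \<Rightarrow> nat \<Rightarrow> nat \<Rightarrow> real" where
  "walk2_prob cRR cLR cRL cLL \<gamma> \<delta> t x =
     (let \<psi> = (walk2_step cRR cLR cRL cLL \<gamma> ^^ t) (walk2_init \<delta>) in
      if x = 0 then (cmod (snd \<psi> 0))\<^sup>2
      else (cmod (fst \<psi> x))\<^sup>2 + (cmod (snd \<psi> x))\<^sup>2)"

definition rho_of :: "complex \<Rightarrow> real" where
  "rho_of b = sqrt (1 - (cmod b)\<^sup>2)"

definition nu2 :: "complex \<Rightarrow> real" where
  "nu2 b = rho_of b / cmod (1 + b)"

definition M_of :: "complex \<Rightarrow> real" where
  "M_of b = (1 + sgn ((cmod b)\<^sup>2 + Re b)) *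
            cmod (complex_of_real ((cmod b)\<^sup>2 + Re b) / (1 + b)\<^sup>2)"

end

theory Submission
  imports Defs "HOL-Analysis.Analysis"
begin

text \<open>
  With \<open>s = \<Delta> z\<^sup>2\<close>, the generating function \<open>K(z)\<close> of the amplitude at the origin solves a quadratic
  equation over the rational functions of \<open>s\<close>, and equals
  \<open>(2 b + 1 - s + \<surd>D(s)) / (2 (1 + b - s (1 + cnj b)))\<close> with \<open>D(s) = 1 - 2 (1 - 2 |b|\<^sup>2) s + s\<^sup>2\<close>.
  The zeros of \<open>D\<close> lie on the unit circle, so \<open>\<surd>D\<close> is a product of binomial series with exponent
  \<open>1/2\<close> and has absolutely summable coefficients. Hence the coefficients of \<open>K\<close> are asymptotically
  governed by the two simple poles \<open>z = \<plusminus> 1 / \<omega>\<close>, where \<open>\<omega>\<^sup>2 = \<Delta> (1 + cnj b) / (1 + b)\<close>, and the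
  residue involves \<open>p + |p|\<close> for \<open>p = |b|\<^sup>2 + Re b\<close>, because \<open>\<surd>D\<close> takes the value
  \<open>2 |p| / (1 + cnj b)\<close> there. Since \<open>cLL \<noteq> 0\<close>, the amplitudes at \<open>x + 1\<close> are determined by those at
  \<open>x\<close>, so the asymptotics at the origin propagate: at \<open>x\<close> the amplitudes follow the eigenvectors for
  \<open>\<plusminus> \<omega>\<close>, which are geometric in \<open>x\<close> with ratio of modulus \<open>\<nu>(b)\<close>.
\<close>

section \<open>Power series with absolutely summable coefficients\<close>

text \<open>The Wiener condition: such series can be evaluated on the whole closed unit disc. This
  matters because the poles of the generating function and the zeros of the discriminant lie on the
  unit circle itself.\<close>

definition abs_summable_fps :: "complex fps \<Rightarrow> bool" where
  "abs_summable_fps F \<longleftrightarrow> summable (\<lambda>n. cmod (fps_nth F n))"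

lemma abs_summable_fps_powser:
  assumes "abs_summable_fps F" "cmod z \<le> 1"
  shows "summable (\<lambda>n. cmod (fps_nth F n * z ^ n))"
proof (rule summable_comparison_test')
  show "summable (\<lambda>n. cmod (fps_nth F n))"
    using assms(1) by (simp add: abs_summable_fps_def)
  show "norm (cmod (fps_nth F n * z ^ n)) \<le> cmod (fps_nth F n)" for n
    using assms(2) by (simp add: norm_mult norm_power mult_left_le power_le_one)
qed

lemma sums_eval_abs_summable_fps:
  assumes "abs_summable_fps F" "cmod z \<le> 1"
  shows "(\<lambda>n. fps_nth F n * z ^ n) sums eval_fps F z"
  unfolding eval_fps_def
  using summable_norm_cancel[OF abs_summable_fps_powser[OF assms]] by (rule summable_sums)

lemma abs_summable_fps_add:
  assumes "abs_summable_fps F" "abs_summable_fps G"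
  shows "abs_summable_fps (F + G)"
  unfolding abs_summable_fps_def
proof (rule summable_comparison_test')
  show "summable (\<lambda>n. cmod (fps_nth F n) + cmod (fps_nth G n))"
    using assms by (auto simp: abs_summable_fps_def intro: summable_add)
qed (simp add: norm_triangle_ineq)

lemma eval_fps_add_closed_disc:
  assumes "abs_summable_fps F" "abs_summable_fps G" "cmod z \<le> 1"
  shows "eval_fps (F + G) z = eval_fps F z + eval_fps G z"
  using sums_add[OF sums_eval_abs_summable_fps[OF assms(1,3)] sums_eval_abs_summable_fps[OF assms(2,3)]]
  by (simp add: eval_fps_def sums_iff algebra_simps)

lemma abs_summable_fps_mult:
  assumes "abs_summable_fps F" "abs_summable_fps G"
  shows "abs_summable_fps (F * G)"
  unfolding abs_summable_fps_def
proof (rule summable_comparison_test')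
  show "summable (\<lambda>n. \<Sum>i\<le>n. cmod (fps_nth F i) * cmod (fps_nth G (n - i)))"
    using assms by (intro summable_Cauchy_product) (auto simp: abs_summable_fps_def)
  show "norm (cmod (fps_nth (F * G) n)) \<le> (\<Sum>i\<le>n. cmod (fps_nth F i) * cmod (fps_nth G (n - i)))" for n
    by (simp add: fps_mult_nth atLeast0AtMost)
       (rule order_trans[OF norm_sum], simp add: norm_mult)
qed

lemma eval_fps_mult_closed_disc:
  assumes "abs_summable_fps F" "abs_summable_fps G" "cmod z \<le> 1"
  shows "eval_fps (F * G) z = eval_fps F z * eval_fps G z"
proof -
  have "eval_fps F z * eval_fps G z =
      (\<Sum>k. \<Sum>i\<le>k. (fps_nth F i * z ^ i) * (fps_nth G (k - i) * z ^ (k - i)))"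
    unfolding eval_fps_def
    by (rule Cauchy_product; rule abs_summable_fps_powser) (use assms in auto)
  also have "\<dots> = (\<Sum>k. fps_nth (F * G) k * z ^ k)"
  proof (rule suminf_cong)
    fix k
    have "(\<Sum>i\<le>k. (fps_nth F i * z ^ i) * (fps_nth G (k - i) * z ^ (k - i)))
        = (\<Sum>i\<le>k. fps_nth F i * fps_nth G (k - i) * z ^ k)"
      by (rule sum.cong) (auto simp: algebra_simps simp flip: power_add)
    then show "(\<Sum>i\<le>k. (fps_nth F i * z ^ i) * (fps_nth G (k - i) * z ^ (k - i)))
        = fps_nth (F * G) k * z ^ k"
      by (simp add: fps_mult_nth atLeast0AtMost sum_distrib_right)
  qed
  finally show ?thesis by (simp add: eval_fps_def)
qed

text \<open>By the Weierstrass M-test. Continuity up to the boundary allows the branch of a square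
  root to be followed from the centre to a point of the circle.\<close>

lemma continuous_on_eval_fps_closed_disc:
  assumes "abs_summable_fps F"
  shows "continuous_on (cball 0 1) (eval_fps F)"
proof (rule uniform_limit_theorem)
  show "uniform_limit (cball 0 1) (\<lambda>n z. \<Sum>i<n. fps_nth F i * z ^ i) (eval_fps F) sequentially"
    unfolding eval_fps_def
  proof (rule Weierstrass_m_test)
    show "summable (\<lambda>n. cmod (fps_nth F n))"
      using assms by (simp add: abs_summable_fps_def)
    show "cmod (fps_nth F n * z ^ n) \<le> cmod (fps_nth F n)" if "z \<in> cball 0 1" for n z
      using that by (simp add: norm_mult norm_power mult_left_le power_le_one)
  qed
qed (auto intro!: always_eventually continuous_intros)

lemma abs_summable_fps_finite:
  assumes "\<And>n. n > N \<Longrightarrow> fps_nth F n = 0"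
  shows "abs_summable_fps F"
  unfolding abs_summable_fps_def
  by (rule summable_finite[of "{..N}"]) (use assms in \<open>auto simp: not_le\<close>)

section \<open>Square roots\<close>

text \<open>The binomial series of \<open>(1 - \<mu> X)^(1/2)\<close>, the square root with constant
  term 1.\<close>

definition sqrt_fps :: "complex \<Rightarrow> complex fps" where
  "sqrt_fps \<mu> = fps_compose (fps_binomial (1/2)) (fps_const (- \<mu>) * fps_X)"

lemma sqrt_fps_square: "sqrt_fps \<mu> * sqrt_fps \<mu> = 1 - fps_const \<mu> * fps_X"
proof -
  have "fps_binomial (1/2) * fps_binomial (1/2) = (1 + fps_X :: complex fps)"
    by (simp add: fps_binomial_1 flip: fps_binomial_add_mult)
  then have "sqrt_fps \<mu> * sqrt_fps \<mu> = fps_compose (1 + fps_X) (fps_const (- \<mu>) * fps_X)"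
    unfolding sqrt_fps_def by (subst fps_compose_mult_distrib[symmetric]) simp_all
  also have "\<dots> = 1 - fps_const \<mu> * fps_X"
    by (simp add: fps_compose_add_distrib fps_const_neg[symmetric] del: fps_const_neg)
  finally show ?thesis .
qed

lemma sqrt_fps_nth_0 [simp]: "fps_nth (sqrt_fps \<mu>) 0 = 1"
  by (simp add: sqrt_fps_def)

text \<open>Telescoping: for \<open>f n = |binom(1/2, n + 1)|\<close> and
  \<open>g n = (n + 1) f n\<close> one has \<open>g n - g (n + 1) = f n / 2\<close>. So
  \<open>g\<close> decreases, is nonnegative and converges, which sums \<open>f\<close>.\<close>

lemma summable_gbinomial_half: "summable (\<lambda>n. cmod ((1/2) gchoose n))"
proof -
  define f where "f n = cmod ((1/2) gchoose (Suc n))" for n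
  define g where "g n = real (Suc n) * f n" for n
  have rec: "g (Suc n) = f n * (real n + 1/2)" for n
  proof -
    have "of_nat (Suc (Suc n)) * ((1/2 :: complex) gchoose Suc (Suc n))
        = (1/2 - of_nat (Suc n)) * ((1/2) gchoose (Suc n))"
      by (simp only: left_diff_distrib gbinomial_mult_1 add_diff_cancel_left')
    then have "cmod (of_nat (Suc (Suc n)) * ((1/2 :: complex) gchoose Suc (Suc n)))
        = cmod (1/2 - of_nat (Suc n)) * f n"
      by (simp add: norm_mult f_def)
    moreover have "(1/2 - of_nat (Suc n) :: complex) = of_real (- (real n + 1/2))"
      by simp
    then have "cmod (1/2 - of_nat (Suc n) :: complex) = real n + 1/2"
      by (simp only: norm_of_real)
    ultimately show ?thesis
      by (simp add: g_def f_def norm_mult mult.commute del: of_nat_Suc)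
  qed
  have diff: "g n - g (Suc n) = f n / 2" for n
    unfolding rec by (simp add: g_def algebra_simps)
  have "decseq g"
    by (rule decseq_SucI) (use diff in \<open>metis diff_ge_0_iff_ge f_def norm_ge_zero half_gt_zero_iff divide_nonneg_nonneg zero_le_numeral\<close>)
  moreover have "0 \<le> g n" for n
    by (simp add: g_def f_def)
  ultimately obtain l where "g \<longlonglongrightarrow> l"
    using decseq_convergent[of g 0] by blast
  then have "summable (\<lambda>n. g n - g (Suc n))"
    by (rule telescope_summable')
  then have "summable (\<lambda>n. f n / 2)" by (simp add: diff)
  then have "summable f" using summable_mult[of "\<lambda>n. f n / 2" 2] by simp
  then show ?thesis unfolding f_def by (subst (asm) summable_Suc_iff)
qed

lemma abs_summable_sqrt_fps:
  assumes "cmod \<mu> = 1"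
  shows "abs_summable_fps (sqrt_fps \<mu>)"
  using summable_gbinomial_half assms
  by (simp add: abs_summable_fps_def sqrt_fps_def fps_compose_linear norm_mult norm_power del: fps_const_neg)

section \<open>The square root of the discriminant and its branch\<close>

text \<open>Equality would mean \<open>s^2 + 2 m s + 1 = 0\<close> for a real \<open>m\<close> with
  \<open>|m| \<le> 1\<close>, but both roots of that quadratic lie on the unit circle. Hence
  \<open>(1 - 2 \<kappa> s + s^2) / (1 + s)^2\<close> is never a nonpositive real in the open
  disc.\<close>

lemma slit_quadratic_no_root:
  fixes s :: complex and k \<kappa> :: real
  assumes "cmod s < 1" "- 1 < \<kappa>" "\<kappa> \<le> 1" "0 \<le> k"
  shows "1 - 2 * of_real \<kappa> * s + s\<^sup>2 \<noteq> - of_real k * (1 + s)\<^sup>2"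
proof
  assume eq: "1 - 2 * of_real \<kappa> * s + s\<^sup>2 = - of_real k * (1 + s)\<^sup>2"
  define m where "m = (k - \<kappa>) / (1 + k)"
  have m: "\<bar>m\<bar> \<le> 1"
    using assms by (auto simp: m_def abs_le_iff field_simps)
  have "of_real (1 + k) * (s\<^sup>2 + 2 * of_real m * s + 1) = 
      of_real (1 + k) * s\<^sup>2 + 2 * of_real ((1 + k) * m) * s + of_real (1 + k)"
    by (simp add: algebra_simps)
  also have "(1 + k) * m = k - \<kappa>"
    using assms by (simp add: m_def)
  also have "of_real (1 + k) * s\<^sup>2 + 2 * of_real (k - \<kappa>) * s + of_real (1 + k) = 0"
    using eq by (simp add: algebra_simps power2_eq_square)
  finally have q: "s\<^sup>2 + 2 * of_real m * s + 1 = 0"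
    using assms(4) by (metis add_nonneg_eq_0_iff mult_eq_0_iff of_real_eq_0_iff zero_le_one zero_neq_one)
  have im: "2 * Im s * (Re s + m) = 0" and re: "(Re s)\<^sup>2 - (Im s)\<^sup>2 + 2 * m * Re s + 1 = 0"
    using arg_cong[OF q, of Im] arg_cong[OF q, of Re]
    by (simp_all add: algebra_simps power2_eq_square)
  have n: "(Re s)\<^sup>2 + (Im s)\<^sup>2 < 1"
    using assms(1) by (simp add: cmod_def)
  \<comment> \<open>For real \<open>s\<close> the quadratic is at least
    \<open>(1 - |s|)^2 > 0\<close>. Otherwise \<open>m = - Re s\<close>, and its real part becomes
    \<open>1 - |s|^2\<close>, again positive.\<close>
  show False
  proof (cases "Im s = 0")
    case True
    then have "\<bar>Re s\<bar> < 1" using n by (simp add: abs_square_less_1)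
    moreover have "- (m * Re s) \<le> \<bar>Re s\<bar>"
      using m by (metis abs_ge_minus_self abs_ge_zero abs_mult dual_order.trans mult.commute mult_left_le)
    moreover have "(1 - \<bar>Re s\<bar>)\<^sup>2 = 1 - 2 * \<bar>Re s\<bar> + (Re s)\<^sup>2"
      by (simp add: power2_diff)
    moreover have "0 < (1 - \<bar>Re s\<bar>)\<^sup>2" using \<open>\<bar>Re s\<bar> < 1\<close> by simp
    ultimately show False using re True by simp
  next
    case False
    then have "m = - Re s" using im by simp
    then show False using re n by (simp add: power2_eq_square)
  qed
qed

text \<open>With \<open>s = \<Delta> z^2\<close> the polynomial is
  \<open>(1 - e s) (1 - cnj e s)\<close> for a unimodular \<open>e\<close>, and each factor splits
  into two linear factors in \<open>z\<close> with zeros on the circle. The product of the four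
  binomial series is the root.\<close>

lemma fps_sqrt_quartic:
  fixes \<Delta> :: complex and \<kappa> :: real
  assumes "cmod \<Delta> = 1" "\<bar>\<kappa>\<bar> \<le> 1"
  obtains C :: "complex fps" where "abs_summable_fps C" "fps_nth C 0 = 1"
    "C * C = 1 - fps_const (2 * of_real \<kappa> * \<Delta>) * fps_X\<^sup>2 + fps_const (\<Delta>\<^sup>2) * fps_X ^ 4"
proof -
  \<comment> \<open>The real part gives \<open>e + cnj e = 2 \<kappa>\<close>; the imaginary part is
    chosen for modulus 1.\<close>
  define e where "e = Complex \<kappa> (sqrt (1 - \<kappa>\<^sup>2))"
  have "1 - \<kappa>\<^sup>2 \<ge> 0" using assms(2) by (simp add: abs_square_le_1)
  then have e1: "cmod e = 1" by (simp add: e_def cmod_def)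
  have esum: "e + cnj e = 2 * of_real \<kappa>" by (simp add: e_def complex_eq_iff)
  have eprod: "e * cnj e = 1" using e1 by (simp add: complex_norm_square[symmetric])
  define m n where "m = csqrt (\<Delta> * e)" and "n = csqrt (\<Delta> * cnj e)"
  have m2: "m * m = \<Delta> * e" and n2: "n * n = \<Delta> * cnj e"
    by (simp_all add: m_def n_def flip: power2_eq_square)
  have mn: "cmod m = 1" "cmod n = 1"
    using assms(1) e1 by (simp_all add: m_def n_def norm_mult norm_csqrt)
  define C where "C = (sqrt_fps m * sqrt_fps (- m)) * (sqrt_fps n * sqrt_fps (- n))"
  have sq: "(sqrt_fps z * sqrt_fps (- z)) * (sqrt_fps z * sqrt_fps (- z)) = 1 - fps_const (z * z) * fps_X\<^sup>2" for z
  proof -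
    have "(sqrt_fps z * sqrt_fps (- z)) * (sqrt_fps z * sqrt_fps (- z))
        = (sqrt_fps z * sqrt_fps z) * (sqrt_fps (- z) * sqrt_fps (- z))"
      by (simp add: mult_ac)
    also have "\<dots> = (1 - fps_const z * fps_X) * (1 + fps_const z * fps_X)"
      by (simp add: sqrt_fps_square fps_const_neg[symmetric] del: fps_const_neg)
    also have "\<dots> = 1 - (fps_const z * fps_const z) * fps_X\<^sup>2"
      by (simp add: algebra_simps power2_eq_square del: fps_const_mult)
    finally show ?thesis by simp
  qed
  have "C * C = (1 - fps_const (\<Delta> * e) * fps_X\<^sup>2) * (1 - fps_const (\<Delta> * cnj e) * fps_X\<^sup>2)"
    unfolding m2[symmetric] n2[symmetric] sq[symmetric] C_def by (simp only: mult_ac)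
  also have "\<dots> = 1 - (fps_const (\<Delta> * e) + fps_const (\<Delta> * cnj e)) * fps_X\<^sup>2
      + fps_const (\<Delta> * e) * fps_const (\<Delta> * cnj e) * fps_X ^ 4"
    by (simp add: algebra_simps flip: power_add del: fps_const_mult fps_const_add)
  also have "fps_const (\<Delta> * e) + fps_const (\<Delta> * cnj e) = fps_const (2 * of_real \<kappa> * \<Delta>)"
    using esum by (simp add: mult.commute flip: distrib_left)
  also have "fps_const (\<Delta> * e) * fps_const (\<Delta> * cnj e) = fps_const (\<Delta>\<^sup>2)"
    using eprod by (simp add: power2_eq_square mult_ac)
  finally have "C * C = 1 - fps_const (2 * of_real \<kappa> * \<Delta>) * fps_X\<^sup>2 + fps_const (\<Delta>\<^sup>2) * fps_X ^ 4" .
  moreover have "abs_summable_fps C"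
    unfolding C_def using mn by (intro abs_summable_fps_mult abs_summable_sqrt_fps) auto
  moreover have "fps_nth C 0 = 1" by (simp add: C_def)
  ultimately show ?thesis using that by blast
qed

lemma eval_fps_X_power: "eval_fps (fps_const c * fps_X ^ k :: complex fps) z = c * z ^ k"
proof -
  have "eval_fps (fps_const c * fps_X ^ k) z = (\<Sum>n. if n = k then c * z ^ k else 0)"
    unfolding eval_fps_def by (rule suminf_cong) (auto simp: fps_X_power_nth)
  then show ?thesis using sums_single[of k "\<lambda>_. c * z ^ k"] by (simp add: sums_iff)
qed

lemma abs_summable_fps_X_power: "abs_summable_fps (fps_const c * fps_X ^ k)"
  by (rule abs_summable_fps_finite[of k]) (simp add: fps_X_power_nth)

lemma abs_summable_fps_const: "abs_summable_fps (fps_const c)"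
  using abs_summable_fps_X_power[of c 0] by simp

lemma eval_sqrt_quartic_square:
  fixes C :: "complex fps"
  assumes "abs_summable_fps C" "cmod z \<le> 1"
    and "C * C = 1 - fps_const (2 * of_real \<kappa> * \<Delta>) * fps_X\<^sup>2 + fps_const (\<Delta>\<^sup>2) * fps_X ^ 4"
  shows "(eval_fps C z)\<^sup>2 = 1 - 2 * of_real \<kappa> * (\<Delta> * z\<^sup>2) + (\<Delta> * z\<^sup>2)\<^sup>2"
proof -
  have "C * C = (fps_const 1 + fps_const (- (2 * of_real \<kappa> * \<Delta>)) * fps_X\<^sup>2) + fps_const (\<Delta>\<^sup>2) * fps_X ^ 4"
    unfolding assms(3) by (simp add: fps_const_neg[symmetric] del: fps_const_neg)
  then have "eval_fps (C * C) z = 1 - 2 * of_real \<kappa> * \<Delta> * z\<^sup>2 + \<Delta>\<^sup>2 * z ^ 4"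
    using assms(2) by (simp only: eval_fps_add_closed_disc abs_summable_fps_add abs_summable_fps_const 
        abs_summable_fps_X_power eval_fps_X_power eval_fps_const) simp
  moreover have "eval_fps (C * C) z = (eval_fps C z)\<^sup>2"
    using assms(1,2) by (simp add: eval_fps_mult_closed_disc power2_eq_square)
  ultimately show ?thesis
    by (simp add: power_mult_distrib mult.assoc flip: power_mult)
qed

text \<open>The branch of the square root is fixed along the radius to the boundary point \<open>w\<close>: inside the
  disc the square of \<open>C / (1 + s)\<close> avoids the nonpositive reals, so that its real part stays
  positive.\<close>

lemma eval_sqrt_quartic_branch:
  fixes C :: "complex fps" and y :: real
  assumes C: "abs_summable_fps C" "fps_nth C 0 = 1"
    "C * C = 1 - fps_const (2 * of_real \<kappa> * \<Delta>) * fps_X\<^sup>2 + fps_const (\<Delta>\<^sup>2) * fps_X ^ 4"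
    and \<kappa>: "- 1 < \<kappa>" "\<kappa> \<le> 1"
    and w: "cmod \<Delta> = 1" "cmod w = 1" "\<Delta> * w\<^sup>2 \<noteq> - 1"
    and y: "0 \<le> y" "1 - 2 * of_real \<kappa> * (\<Delta> * w\<^sup>2) + (\<Delta> * w\<^sup>2)\<^sup>2 = (of_real y * (1 + \<Delta> * w\<^sup>2))\<^sup>2"
  shows "eval_fps C w = of_real y * (1 + \<Delta> * w\<^sup>2)"
proof -
  define s where "s r = \<Delta> * (of_real r * w)\<^sup>2" for r :: real
  define g where "g r = eval_fps C (of_real r * w) / (1 + s r)" for r :: real
  have ns: "cmod (s r) = r\<^sup>2" for r
    using w by (simp add: s_def norm_mult norm_power)
  \<comment> \<open>For \<open>r < 1\<close> the modulus of \<open>s r\<close> is below 1; at the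
    endpoint the assumption \<open>\<Delta> * w^2 \<noteq> -1\<close> takes over.\<close>
  have nz: "1 + s r \<noteq> 0" if "0 \<le> r" "r \<le> 1" for r
  proof (cases "r = 1")
    case True
    then show ?thesis using w(3) by (auto simp: s_def add_eq_0_iff)
  next
    case False
    then have "cmod (s r) < 1" using that by (simp add: ns power_less_one_iff)
    then show ?thesis by (auto simp: add_eq_0_iff)
  qed
  have disc: "cmod (of_real r * w) \<le> 1" if "0 \<le> r" "r \<le> 1" for r :: real
    using w that by (simp add: norm_mult)
  have cont: "continuous_on {0..1} g"
    unfolding g_def
  proof (rule continuous_on_divide)
    have "continuous_on {0..1} (eval_fps C \<circ> (\<lambda>r. of_real r * w))"
      by (rule continuous_on_compose[OF _ continuous_on_subset[OF continuous_on_eval_fps_closed_disc[OF C(1)]]])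
         (use disc in \<open>auto intro!: continuous_intros\<close>)
    then show "continuous_on {0..1} (\<lambda>r. eval_fps C (of_real r * w))"
      by (simp add: o_def)
  qed (use nz in \<open>auto simp: s_def intro!: continuous_intros\<close>)
  have sq: "(g r * (1 + s r))\<^sup>2 = 1 - 2 * of_real \<kappa> * s r + (s r)\<^sup>2" if "0 \<le> r" "r \<le> 1" for r
    using eval_sqrt_quartic_square[OF C(1) disc[OF that] C(3)] nz[OF that]
    by (simp add: g_def s_def)
  \<comment> \<open>A purely imaginary \<open>g r\<close> would have a nonpositive real square,
    which \<open>slit_quadratic_no_root\<close> excludes inside the disc.\<close>
  have Re_nz: "Re (g r) \<noteq> 0" if "0 \<le> r" "r < 1" for r
  proof
    assume "Re (g r) = 0"
    then have "(g r)\<^sup>2 = - of_real ((Im (g r))\<^sup>2)"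
      by (simp add: complex_eq_iff power2_eq_square)
    then have "1 - 2 * of_real \<kappa> * s r + (s r)\<^sup>2 = - of_real ((Im (g r))\<^sup>2) * (1 + s r)\<^sup>2"
      using sq[of r] that by (simp add: power_mult_distrib)
    moreover have "cmod (s r) < 1" using that by (simp add: ns power_less_one_iff)
    ultimately show False using slit_quadratic_no_root[OF _ \<kappa>] by (metis zero_le_power2)
  qed
  have g0: "g 0 = 1" using C(2) by (simp add: g_def s_def eval_fps_at_0)
  \<comment> \<open>Since \<open>g 0 = 1\<close>, a negative value at the endpoint would force a
    zero of the real part at some \<open>r < 1\<close>.\<close>
  have "Re (g 1) \<ge> 0"
  proof (rule ccontr)
    assume neg: "\<not> Re (g 1) \<ge> 0"
    have "continuous_on {0..1} (\<lambda>r. Re (g r))"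
      using cont by (intro continuous_intros)
    then have "\<exists>r\<ge>0. r \<le> 1 \<and> Re (g r) = 0"
      using IVT2'[of "\<lambda>r. Re (g r)" 1 0 0] neg g0 by auto
    then obtain r where "0 \<le> r" "r \<le> 1" "Re (g r) = 0" by blast
    then show False using Re_nz[of r] neg by (cases "r = 1") auto
  qed
  \<comment> \<open>The squares agree at the endpoint, so only the sign is open; the sign of the
    real part settles it.\<close>
  moreover have "g 1 = of_real y \<or> g 1 = - of_real y"
  proof -
    have "(g 1)\<^sup>2 * (1 + s 1)\<^sup>2 = (of_real y)\<^sup>2 * (1 + s 1)\<^sup>2"
      using sq[of 1] y(2) by (simp add: s_def power_mult_distrib)
    then show ?thesis using nz[of 1] by (simp add: power2_eq_iff)
  qed
  ultimately have "g 1 = of_real y" using y(1) by auto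
  then show ?thesis using nz[of 1] by (simp add: g_def s_def field_simps)
qed

section \<open>Coefficient asymptotics from a simple pole on the unit circle\<close>

text \<open>The second factor is \<open>1 / (1 - \<mu> X)\<close>, so coefficient \<open>n\<close>
  of the product is \<open>\<mu>^n\<close> times a partial sum of \<open>H\<close> at
  \<open>1 / \<mu>\<close>. These partial sums converge because \<open>1 / \<mu>\<close> is in the
  closed disc.\<close>

lemma convolution_geometric_asymp:
  assumes "abs_summable_fps H" "cmod \<mu> = 1"
  shows "(\<lambda>n. fps_nth (H * Abs_fps (\<lambda>n. \<mu> ^ n)) n - \<mu> ^ n * eval_fps H (1 / \<mu>)) \<longlonglongrightarrow> 0"
proof -
  have nz: "\<mu> \<noteq> 0" using assms(2) by auto
  have eq: "fps_nth (H * Abs_fps (\<lambda>n. \<mu> ^ n)) n = \<mu> ^ n * (\<Sum>i\<le>n. fps_nth H i * (1 / \<mu>) ^ i)" for n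
    unfolding fps_mult_nth atLeast0AtMost sum_distrib_left
    by (rule sum.cong) (use nz in \<open>auto simp: power_diff power_divide\<close>)
  have "(\<lambda>n. \<Sum>i\<le>n. fps_nth H i * (1 / \<mu>) ^ i) \<longlonglongrightarrow> eval_fps H (1 / \<mu>)"
    using sums_eval_abs_summable_fps[OF assms(1), of "1 / \<mu>"] assms(2)
    by (simp add: sums_def_le norm_divide)
  then have "(\<lambda>n. (\<Sum>i\<le>n. fps_nth H i * (1 / \<mu>) ^ i) - eval_fps H (1 / \<mu>)) \<longlonglongrightarrow> 0"
    by (simp add: LIM_zero)
  then have "(\<lambda>n. cmod ((\<Sum>i\<le>n. fps_nth H i * (1 / \<mu>) ^ i) - eval_fps H (1 / \<mu>))) \<longlonglongrightarrow> 0"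
    by (simp add: tendsto_norm_zero)
  then have "(\<lambda>n. cmod (\<mu> ^ n * ((\<Sum>i\<le>n. fps_nth H i * (1 / \<mu>) ^ i) - eval_fps H (1 / \<mu>)))) \<longlonglongrightarrow> 0"
    using assms(2) by (simp add: norm_mult norm_power)
  then show ?thesis
    unfolding eq by (subst tendsto_norm_zero_iff[symmetric]) (simp add: right_diff_distrib)
qed

section \<open>The amplitude at the origin\<close>

text \<open>Write the quadratic as \<open>T K^2 - B K + b = 0\<close>. Its discriminant
  \<open>B^2 - 4 b T\<close> equals \<open>C^2\<close>, and \<open>K = (B + C) / (2 T)\<close> is
  the root with constant term 1; the other sign would give \<open>b / (1 + b)\<close>.\<close>

lemma origin_fps:
  fixes b \<Delta> \<omega> :: complex
  defines "p \<equiv> (cmod b)\<^sup>2 + Re b"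
  defines "s \<equiv> fps_const \<Delta> * fps_X\<^sup>2"
  assumes b: "cmod b < 1" and \<Delta>: "cmod \<Delta> = 1" and \<omega>: "\<omega>\<^sup>2 = \<Delta> * (1 + cnj b) / (1 + b)"
  obtains K :: "complex fps" where "fps_nth K 0 = 1"
    "K\<^sup>2 * (fps_const (1 + b) - s * fps_const (1 + cnj b)) - K * (fps_const (2 * b + 1) - s) + fps_const b = 0"
    "(\<lambda>n. fps_nth K n - (1 + (-1) ^ n) / 2 * of_real ((p + \<bar>p\<bar>) / (cmod (1 + b))\<^sup>2) * \<omega> ^ n) \<longlonglongrightarrow> 0"
proof -
  define \<kappa> where "\<kappa> = 1 - 2 * (cmod b)\<^sup>2"
  have "(cmod b)\<^sup>2 < 1" using b by (simp add: power_less_one_iff)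
  then have \<kappa>: "- 1 < \<kappa>" "\<kappa> \<le> 1" "\<bar>\<kappa>\<bar> \<le> 1" by (auto simp: \<kappa>_def abs_le_iff)
  have bnz: "1 + b \<noteq> 0" using b by (metis add_eq_0_iff norm_minus_cancel norm_one less_irrefl)
  then have cbnz: "1 + cnj b \<noteq> 0" by (metis complex_cnj_add complex_cnj_one complex_cnj_zero_iff)
  have Reb: "1 + Re b > 0" using b abs_Re_le_cmod[of b] by linarith
  have ncb: "cmod (1 + cnj b) = cmod (1 + b)"
    by (metis complex_cnj_add complex_cnj_one complex_mod_cnj)
  have "(cmod \<omega>)\<^sup>2 = 1"
    using \<omega> \<Delta> ncb bnz by (simp add: norm_mult norm_divide flip: norm_power)
  then have n\<omega>: "cmod \<omega> = 1" by (simp add: power2_eq_1_iff) (metis norm_ge_zero not_one_le_zero neg_0_le_iff_le)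
  have \<Delta>nz: "\<Delta> \<noteq> 0" and \<omega>nz: "\<omega> \<noteq> 0" using \<Delta> n\<omega> by auto
  have bb: "b * cnj b = of_real ((cmod b)\<^sup>2)" by (rule complex_norm_square[symmetric])
  obtain C :: "complex fps" where C: "abs_summable_fps C" "fps_nth C 0 = 1"
    "C * C = 1 - fps_const (2 * of_real \<kappa> * \<Delta>) * fps_X\<^sup>2 + fps_const (\<Delta>\<^sup>2) * fps_X ^ 4"
    using fps_sqrt_quartic[OF \<Delta> \<kappa>(3)] by blast
  define B where "B = fps_const (2 * b + 1) - s"
  define H where "H = B + C"
  have B': "B = fps_const (2 * b + 1) + fps_const (- \<Delta>) * fps_X\<^sup>2"
    by (simp add: B_def s_def fps_const_neg[symmetric] del: fps_const_neg)
  have H: "abs_summable_fps H"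
    unfolding H_def B' by (intro abs_summable_fps_add abs_summable_fps_const abs_summable_fps_X_power C(1))

  \<comment> \<open>These \<open>w\<close> are \<open>1 / \<omega>\<close> and
    \<open>- 1 / \<omega>\<close>, the zeros of \<open>T\<close>. There \<open>B\<close> contributes
    the term with \<open>p\<close> and \<open>C\<close> the term with \<open>|p|\<close>.\<close>
  have evalH: "eval_fps H w = of_real (2 * (p + \<bar>p\<bar>)) / (1 + cnj b)"
    if w: "w\<^sup>2 = (1 + b) / (\<Delta> * (1 + cnj b))" "cmod w = 1" for w
  proof -
    define s0 where "s0 = \<Delta> * w\<^sup>2"
    have s0: "s0 = (1 + b) / (1 + cnj b)" using \<Delta>nz by (simp add: s0_def w(1))
    have s1: "1 + s0 = of_real (2 * (1 + Re b)) / (1 + cnj b)"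
    proof -
      have "1 + s0 = ((1 + cnj b) + (1 + b)) / (1 + cnj b)"
        unfolding s0 using add_divide_eq_iff[OF cbnz, of 1 "1 + b"] by simp
      also have "(1 + cnj b) + (1 + b) = of_real (2 * (1 + Re b))"
        by (simp add: complex_eq_iff)
      finally show ?thesis .
    qed
    have d: "2 * b + 1 - s0 = of_real (2 * p) / (1 + cnj b)"
    proof -
      have "2 * b + 1 - s0 = ((2 * b + 1) * (1 + cnj b) - (1 + b)) / (1 + cnj b)"
        unfolding s0 using cbnz by (rule diff_divide_eq_iff)
      also have "(2 * b + 1) * (1 + cnj b) - (1 + b) = 2 * (b * cnj b) + (b + cnj b)"
        by (simp add: algebra_simps)
      also have "\<dots> = of_real (2 * p)"
        unfolding bb complex_add_cnj p_def by simp
      finally show ?thesis .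
    qed
    \<comment> \<open>This fixes the real factor \<open>y\<close> required by the branch lemma: the
      candidate value of \<open>C\<close>, divided by \<open>1 + s0\<close>, is real and
      nonnegative.\<close>
    have c: "of_real (\<bar>p\<bar> / (1 + Re b)) * (1 + s0) = of_real (2 * \<bar>p\<bar>) / (1 + cnj b)"
    proof -
      have "of_real (\<bar>p\<bar> / (1 + Re b)) * (1 + s0)
          = of_real (\<bar>p\<bar> / (1 + Re b) * (2 * (1 + Re b))) / (1 + cnj b)"
        unfolding s1 by simp
      also have "\<bar>p\<bar> / (1 + Re b) * (2 * (1 + Re b)) = 2 * \<bar>p\<bar>" using Reb by (simp add: field_simps)
      finally show ?thesis .
    qed
    \<comment> \<open>As \<open>T\<close> vanishes at \<open>s0\<close>, the discriminant reduces to
      \<open>B^2\<close> there.\<close>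
    have "(1 + b - s0 * (1 + cnj b)) = 0" using cbnz by (simp add: s0)
    moreover have "(2 * b + 1 - s0)\<^sup>2 - 4 * b * (1 + b - s0 * (1 + cnj b))
        = 1 - 2 * s0 + s0\<^sup>2 + 4 * (b * cnj b) * s0"
      by (simp add: power2_eq_square algebra_simps)
    ultimately have "1 - 2 * of_real \<kappa> * s0 + s0\<^sup>2 = (2 * b + 1 - s0)\<^sup>2"
      unfolding bb by (simp add: \<kappa>_def algebra_simps)
    also have "\<dots> = (of_real (\<bar>p\<bar> / (1 + Re b)) * (1 + s0))\<^sup>2"
    proof -
      have "(2 * p)\<^sup>2 = (2 * \<bar>p\<bar>)\<^sup>2" by (simp add: power_mult_distrib)
      then show ?thesis unfolding d c power_divide of_real_power[symmetric] by (rule arg_cong)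
    qed
    finally have sq: "1 - 2 * of_real \<kappa> * s0 + s0\<^sup>2 = (of_real (\<bar>p\<bar> / (1 + Re b)) * (1 + s0))\<^sup>2" .
    have "1 + s0 \<noteq> 0" unfolding s1 using Reb cbnz by (simp only: divide_eq_0_iff of_real_eq_0_iff) auto
    then have "s0 \<noteq> - 1" by auto
    then have "eval_fps C w = of_real (\<bar>p\<bar> / (1 + Re b)) * (1 + s0)"
      unfolding s0_def
      by (intro eval_sqrt_quartic_branch[OF C \<kappa>(1,2) \<Delta> w(2)] sq[unfolded s0_def])
         (use Reb in auto)
    also note c
    finally have "eval_fps C w = of_real (2 * \<bar>p\<bar>) / (1 + cnj b)" .
    moreover have "eval_fps B w = 2 * b + 1 - s0"
      unfolding B' using w(2) by (simp only: eval_fps_add_closed_disc abs_summable_fps_const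
        abs_summable_fps_X_power eval_fps_X_power eval_fps_const) (simp add: s0_def)
    moreover have "eval_fps H w = eval_fps B w + eval_fps C w"
      unfolding H_def B' using w(2) 
      by (intro eval_fps_add_closed_disc abs_summable_fps_add abs_summable_fps_const abs_summable_fps_X_power C(1)) simp
    ultimately show ?thesis unfolding d by (simp add: add_divide_distrib algebra_simps)
  qed

  define Q where "Q \<mu> = Abs_fps (\<lambda>n. \<mu> ^ n)" for \<mu> :: complex
  have Q: "Q \<mu> * (1 - fps_const \<mu> * fps_X) = 1" for \<mu>
  proof -
    have "(1 - fps_const \<mu> * fps_X) * Q \<mu> = 1"
      by (rule fps_ext) (auto simp: Q_def left_diff_distrib mult.assoc power_eq_if)
    then show ?thesis by (simp add: mult.commute)
  qed
  \<comment> \<open>Partial fractions: \<open>T = (1 + b) (1 - \<omega> X) (1 + \<omega> X)\<close>,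
    and \<open>Q \<omega> + Q (- \<omega>)\<close> is twice the inverse of the last two factors. So
    this is \<open>H / (2 T)\<close>.\<close>
  define K where "K = fps_const (1 / (4 * (1 + b))) * (H * Q \<omega> + H * Q (- \<omega>))"
  define T where "T = fps_const (1 + b) - s * fps_const (1 + cnj b)"
  have T: "T = fps_const (1 + b) * ((1 - fps_const \<omega> * fps_X) * (1 - fps_const (- \<omega>) * fps_X))"
  proof -
    have "(1 - fps_const \<omega> * fps_X) * (1 - fps_const (- \<omega>) * fps_X)
      = 1 - fps_const \<omega> * fps_const \<omega> * fps_X\<^sup>2"
      by (simp add: algebra_simps power2_eq_square fps_const_neg[symmetric] del: fps_const_neg fps_const_mult)
    also have "\<dots> = 1 - fps_const (\<omega>\<^sup>2) * fps_X\<^sup>2" by (simp add: power2_eq_square)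
    also have "fps_const (1 + b) * \<dots> = fps_const (1 + b) - fps_const ((1 + b) * \<omega>\<^sup>2) * fps_X\<^sup>2"
      by (simp only: right_diff_distrib mult_1_left mult_1_right fps_const_mult[symmetric] mult_ac)
    also have "(1 + b) * \<omega>\<^sup>2 = \<Delta> * (1 + cnj b)" using bnz by (simp add: \<omega>)
    finally show ?thesis
      by (simp only: T_def s_def fps_const_mult[symmetric] mult_ac)
  qed
  have KT: "2 * (K * T) = H"
  proof -
    have "(Q \<omega> + Q (- \<omega>)) * ((1 - fps_const \<omega> * fps_X) * (1 - fps_const (- \<omega>) * fps_X))
      = (Q \<omega> * (1 - fps_const \<omega> * fps_X)) * (1 - fps_const (- \<omega>) * fps_X)
        + (Q (- \<omega>) * (1 - fps_const (- \<omega>) * fps_X)) * (1 - fps_const \<omega> * fps_X)"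
      by (simp only: algebra_simps)
    also have "\<dots> = 2"
      unfolding Q by (simp add: fps_const_neg[symmetric] del: fps_const_neg)
    finally have two: "(Q \<omega> + Q (- \<omega>)) * ((1 - fps_const \<omega> * fps_X) * (1 - fps_const (- \<omega>) * fps_X)) = 2" .
    have "K * T = fps_const (1 / (4 * (1 + b))) * fps_const (1 + b) * H
        * ((Q \<omega> + Q (- \<omega>)) * ((1 - fps_const \<omega> * fps_X) * (1 - fps_const (- \<omega>) * fps_X)))"
      unfolding K_def T distrib_left[symmetric] by (simp only: mult_ac)
    also have "fps_const (1 / (4 * (1 + b))) * fps_const (1 + b) = fps_const (1 / 4)"
    proof -
      have "1 / (4 * u) * u = 1 / 4" if "u \<noteq> 0" for u :: complex using that by simp
      from this[OF bnz] show ?thesis by (simp only: fps_const_mult)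
    qed
    also note two
    finally have "2 * (K * T) = (2 * 2 * fps_const (1 / 4)) * H" by (simp only: mult_ac)
    also have "2 * 2 * fps_const (1 / 4) = (1 :: complex fps)"
      by (simp add: fps_numeral_fps_const)
    finally show ?thesis by simp
  qed
  have "fps_nth H 0 = 2 * (1 + b)" by (simp add: H_def B' C(2))
  then have K0: "fps_nth K 0 = 1"
  proof -
    have "1 / (4 * u) * (2 * u + 2 * u) = 1" if "u \<noteq> 0" for u :: complex using that by simp
    from this[OF bnz] show ?thesis
      using \<open>fps_nth H 0 = 2 * (1 + b)\<close>
      by (simp only: K_def Q_def fps_mult_left_const_nth fps_add_nth fps_mult_nth_0 fps_nth_Abs_fps power_0 mult_1_right fps_nth_fps_const simp_thms if_True)
  qed
  have Tnz: "T \<noteq> 0"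
  proof
    assume "T = 0"
    moreover have "fps_nth T 0 = 1 + b" by (simp add: T_def s_def)
    ultimately show False using bnz by simp
  qed
  have CC: "C * C = B\<^sup>2 - 4 * fps_const b * T"
  proof -
    have "B\<^sup>2 - 4 * fps_const b * T = 1 - 2 * s + s\<^sup>2 + 4 * (fps_const b * fps_const (cnj b)) * s"
    proof -
      have B2: "B = 2 * fps_const b + 1 - s"
        by (simp add: B_def fps_numeral_fps_const)
      have T2: "T = 1 + fps_const b - s * (1 + fps_const (cnj b))"
        by (simp add: T_def fps_const_add[symmetric] del: fps_const_add)
      show ?thesis unfolding B2 T2 by (simp add: power2_eq_square algebra_simps del: fps_const_mult fps_const_add)
    qed
    also have "4 * (fps_const b * fps_const (cnj b)) = 2 - fps_const (2 * of_real \<kappa>)"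
      by (simp add: bb \<kappa>_def fps_numeral_fps_const)
    also have "1 - 2 * s + s\<^sup>2 + (2 - fps_const (2 * of_real \<kappa>)) * s = 1 - fps_const (2 * of_real \<kappa>) * s + s\<^sup>2"
      by (simp add: algebra_simps)
    also have "\<dots> = C * C"
      unfolding C(3) s_def by (simp add: power_mult_distrib mult.assoc[symmetric] fps_const_power flip: power_mult)
    finally show ?thesis ..
  qed
  \<comment> \<open>Completing the square: with \<open>2 K T = B + C\<close> the right side becomes
    \<open>C^2 - B^2 + 4 b T\<close>, which is zero. The factor \<open>T\<close> is then
    cancelled.\<close>
  have "4 * T * (K\<^sup>2 * T - K * B + fps_const b) = (2 * (K * T))\<^sup>2 - 2 * B * (2 * (K * T)) + 4 * fps_const b * T"
    by (simp add: power2_eq_square algebra_simps)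
  also have "\<dots> = C * C - B\<^sup>2 + 4 * fps_const b * T"
    unfolding KT H_def by (simp add: power2_eq_square algebra_simps)
  finally have "4 * T * (K\<^sup>2 * T - K * B + fps_const b) = 0" unfolding CC by simp
  then have quad: "K\<^sup>2 * T - K * B + fps_const b = 0" using Tnz by simp

  define h where "h = of_real (2 * (p + \<bar>p\<bar>)) / (1 + cnj b)"
  have "eval_fps H (1 / \<omega>) = h"
    unfolding h_def by (rule evalH) (simp_all add: \<omega> n\<omega> power_divide norm_divide)
  moreover have "eval_fps H (1 / (- \<omega>)) = h"
    unfolding h_def by (rule evalH) (simp_all add: \<omega> n\<omega> power_divide norm_divide)
  ultimately have lim: "(\<lambda>n. fps_nth (H * Q \<omega>) n - \<omega> ^ n * h) \<longlonglongrightarrow> 0" "(\<lambda>n. fps_nth (H * Q (- \<omega>)) n - (- \<omega>) ^ n * h) \<longlonglongrightarrow> 0"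
    using convolution_geometric_asymp[OF H, of \<omega>] convolution_geometric_asymp[OF H, of "- \<omega>"] n\<omega>
    by (simp_all add: Q_def)
  \<comment> \<open>The residue becomes real because
    \<open>(1 + b) (1 + cnj b) = |1 + b|^2\<close>.\<close>
  have hc: "1 / (4 * (1 + b)) * h = of_real ((p + \<bar>p\<bar>) / (cmod (1 + b))\<^sup>2) / 2"
  proof -
    have *: "of_real ((cmod (1 + b))\<^sup>2) = (1 + b) * (1 + cnj b)" by (simp only: complex_norm_square) simp
    have "1 / (4 * u) * (2 * x / v) = x / (u * v) / 2" for u v x :: complex by simp
    then show ?thesis unfolding h_def of_real_divide * of_real_mult of_real_numeral .
  qed
  have "(\<lambda>n. 1 / (4 * (1 + b)) * ((fps_nth (H * Q \<omega>) n - \<omega> ^ n * h) + (fps_nth (H * Q (- \<omega>)) n - (- \<omega>) ^ n * h))) \<longlonglongrightarrow> 1 / (4 * (1 + b)) * (0 + 0)"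
    by (intro tendsto_intros lim)
  moreover have "1 / (4 * (1 + b)) * ((fps_nth (H * Q \<omega>) n - \<omega> ^ n * h) + (fps_nth (H * Q (- \<omega>)) n - (- \<omega>) ^ n * h))
      = fps_nth K n - (1 + (-1) ^ n) / 2 * of_real ((p + \<bar>p\<bar>) / (cmod (1 + b))\<^sup>2) * \<omega> ^ n" for n
  proof -
    have "1 / (4 * (1 + b)) * ((fps_nth (H * Q \<omega>) n - \<omega> ^ n * h) + (fps_nth (H * Q (- \<omega>)) n - (- \<omega>) ^ n * h))
      = fps_nth K n - (\<omega> ^ n + (- \<omega>) ^ n) * (1 / (4 * (1 + b)) * h)"
    proof -
      have "c * ((x - w * h) + (y - w' * h)) = c * (x + y) - (w + w') * (c * h)" for c w w' x y :: complex
        by (simp add: algebra_simps)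
      then show ?thesis by (simp only: K_def fps_mult_left_const_nth fps_add_nth)
    qed
    also have "(\<omega> ^ n + (- \<omega>) ^ n) * (1 / (4 * (1 + b)) * h)
        = (1 + (-1) ^ n) / 2 * of_real ((p + \<bar>p\<bar>) / (cmod (1 + b))\<^sup>2) * \<omega> ^ n"
    proof -
      have "(\<omega> ^ n + (- \<omega>) ^ n) * (A / 2) = (1 + (-1) ^ n) / 2 * A * \<omega> ^ n" for A
        unfolding power_minus[of \<omega>] by (simp add: algebra_simps)
      then show ?thesis unfolding hc .
    qed
    finally show ?thesis .
  qed
  ultimately have "(\<lambda>n. fps_nth K n - (1 + (-1) ^ n) / 2 * of_real ((p + \<bar>p\<bar>) / (cmod (1 + b))\<^sup>2) * \<omega> ^ n) \<longlonglongrightarrow> 0"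
    by simp
  with K0 quad show ?thesis unfolding T_def B_def by (rule that)
qed

section \<open>The walk\<close>

text \<open>The first two relations compare the adjoint of \<open>U\<close> with its inverse,
  written as adjugate over determinant. Substituting them into the norm of the second row gives
  \<open>|\<Delta>| = 1\<close>.\<close>

lemma unitary2_relations:
  assumes "unitary2 cRR cLR cRL cLL"
  defines "\<Delta> \<equiv> coin_det cRR cLR cRL cLL"
  shows "cRL = - \<Delta> * cnj cLR" "cLL = \<Delta> * cnj cRR" "cmod \<Delta> = 1" "(cmod cRR)\<^sup>2 + (cmod cLR)\<^sup>2 = 1"
proof -
  have u: "cRR * cnj cRR + cLR * cnj cLR = 1" "cRL * cnj cRR + cLL * cnj cLR = 0"
    "cRL * cnj cRL + cLL * cnj cLL = 1"
    using assms(1) by (auto simp: unitary2_def)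
  show 1: "cRL = - \<Delta> * cnj cLR"
    using u unfolding \<Delta>_def coin_det_def by algebra
  show 2: "cLL = \<Delta> * cnj cRR"
    using u unfolding \<Delta>_def coin_det_def by algebra
  have "(\<Delta> * cnj \<Delta>) * (cRR * cnj cRR + cLR * cnj cLR) = 1"
    using u(3) unfolding 1 2 by (simp add: algebra_simps)
  then have "\<Delta> * cnj \<Delta> = 1" using u(1) by simp
  then have "of_real ((cmod \<Delta>)\<^sup>2) = (1 :: complex)" by (simp only: complex_norm_square)
  then have "(cmod \<Delta>)\<^sup>2 = 1" using of_real_eq_1_iff by blast
  then show "cmod \<Delta> = 1" by (simp add: power2_eq_1_iff) (smt (verit) norm_ge_zero)
  have "of_real ((cmod cRR)\<^sup>2 + (cmod cLR)\<^sup>2) = (1 :: complex)"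
    using u(1) unfolding of_real_add by (simp only: complex_norm_square)
  then show "(cmod cRR)\<^sup>2 + (cmod cLR)\<^sup>2 = 1" using of_real_eq_1_iff by blast
qed

text \<open>The generating functions \<open>R x\<close>, \<open>L x\<close> of the amplitudes are geometric in \<open>x\<close>: \<open>q\<close> is the
  weight of passing from \<open>x\<close> to \<open>x + 1\<close>.\<close>

lemma walk2_amplitude_origin:
  fixes K :: "complex fps" and b \<Delta> :: complex and \<gamma> :: real
  defines "g \<equiv> exp (\<i> * of_real \<gamma>)"
  defines "s \<equiv> fps_const \<Delta> * fps_X\<^sup>2"
  assumes coin: "cLR * g = \<Delta> * cnj b" "cRL = - b * g" "cLL * cRR = \<Delta> * (1 - b * cnj b)"
    and K0: "fps_nth K 0 = 1"
    and quad: "K\<^sup>2 * (fps_const (1 + b) - s * fps_const (1 + cnj b)) - K * (fps_const (2 * b + 1) - s) + fps_const b = 0"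
  shows "snd ((walk2_step cRR cLR cRL cLL \<gamma> ^^ t) (walk2_init \<delta>)) 0 = exp (\<i> * of_real \<delta>) * fps_nth K t"
proof -
  define E where "E = fps_const (exp (\<i> * of_real \<delta>))"
  \<comment> \<open>The recursion for \<open>R\<close> forces
    \<open>q (r - X cRL l) = X cRR r\<close>, and \<open>r - X cRL l = X E g D\<close>; this
    dictates \<open>q\<close>. The constant term 1 makes \<open>D\<close> invertible.\<close>
  define D where "D = fps_const (1 + b) * K - fps_const b"
  define q where "q = fps_const cRR * fps_X * K * inverse D"
  define r where "r = fps_X * (fps_const g * (E * K))"
  define l where "l = E * (K - 1)"
  \<comment> \<open>The powers of \<open>q\<close> start at position 1 for \<open>R\<close> and at 0
    for \<open>L\<close>. The initial amplitude \<open>E\<close> is separated from the geometric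
    part, so that \<open>L 0 = E K\<close>.\<close>
  define R where "R x = (case x of 0 \<Rightarrow> 0 | Suc y \<Rightarrow> r * q ^ y)" for x
  define L where "L x = (if x = 0 then E else 0) + l * q ^ x" for x :: nat
  have D0: "fps_nth D 0 = 1" by (simp add: D_def K0)
  then have Dinv: "inverse D * D = 1" and Dnz: "D \<noteq> 0"
    by (auto intro: inverse_mult_eq_1)
  have qD: "q * D = fps_const cRR * fps_X * K"
    unfolding q_def by (simp add: mult.assoc Dinv)
  have c1: "fps_const cLR * fps_const g = fps_const \<Delta> * fps_const (cnj b)"
    and c2: "fps_const cRL = - fps_const b * fps_const g"
    and c3: "fps_const cLL * fps_const cRR = fps_const \<Delta> * (1 - fps_const b * fps_const (cnj b))"
    using coin by (simp_all add: fps_const_sub fps_const_1_eq_1[symmetric] del: fps_const_1_eq_1)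
  have D': "D = (1 + fps_const b) * K - fps_const b"
    by (simp add: D_def fps_const_add[symmetric] del: fps_const_add)
  have quad': "K\<^sup>2 * (1 + fps_const b - s * (1 + fps_const (cnj b))) - K * (2 * fps_const b + 1 - s) + fps_const b = 0"
    using quad by (simp add: fps_const_add[symmetric] fps_const_mult[symmetric] fps_numeral_fps_const[symmetric] del: fps_const_add fps_const_mult)
  have e2: "r * q = fps_X * (fps_const cRR * r + fps_const cRL * (l * q))"
  proof -
    have "(r - fps_X * fps_const cRL * l) = fps_X * E * fps_const g * D"
      unfolding c2 r_def l_def D' by (simp add: algebra_simps del: fps_const_mult fps_const_neg)
    then have "(r - fps_X * fps_const cRL * l) * q = fps_X * E * fps_const g * (q * D)"
      by (simp add: mult_ac)
    then show ?thesis unfolding qD by (simp add: r_def algebra_simps)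
  qed
  \<comment> \<open>This is where the quadratic enters: after multiplication by \<open>D\<close> the
    relation reduces to \<open>s ((1 + cnj b) K^2 - K) = (K - 1) D\<close>, a rearrangement of
    \<open>quad\<close>.\<close>
  have e1: "l = fps_X * (fps_const cLR * r + fps_const cLL * (l * q))"
  proof -
    have "D * (fps_X * (fps_const cLR * r + fps_const cLL * (l * q)))
      = fps_X * fps_const cLR * r * D + fps_X * fps_const cLL * l * (q * D)"
      by (simp add: algebra_simps)
    also have "\<dots> = (fps_const cLR * fps_const g) * fps_X\<^sup>2 * E * K * D
        + (fps_const cLL * fps_const cRR) * fps_X\<^sup>2 * l * K"
      unfolding qD r_def by (simp add: power2_eq_square mult_ac del: fps_const_mult)
    also have "\<dots> = E * s * (fps_const (cnj b) * K * D + (1 - fps_const b * fps_const (cnj b)) * (K - 1) * K)"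
      unfolding c1 c3 l_def s_def by (simp add: algebra_simps del: fps_const_mult)
    also have "\<dots> = E * (s * ((1 + fps_const (cnj b)) * K\<^sup>2 - K))"
      unfolding D' by (simp add: algebra_simps power2_eq_square del: fps_const_mult)
    also have "s * ((1 + fps_const (cnj b)) * K\<^sup>2 - K) = (K - 1) * D"
      unfolding D' using quad' by (simp add: algebra_simps power2_eq_square del: fps_const_mult)
    finally have "D * (fps_X * (fps_const cLR * r + fps_const cLL * (l * q))) = D * l"
      by (simp add: l_def mult_ac)
    then show ?thesis using Dnz by simp
  qed
  \<comment> \<open>The recursion and the initial state determine the walk, so it suffices that the
    coefficients of the ansatz satisfy both.\<close>
  have "(walk2_step cRR cLR cRL cLL \<gamma> ^^ t) (walk2_init \<delta>) = ((\<lambda>x. fps_nth (R x) t), (\<lambda>x. fps_nth (L x) t))"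
  proof (induction t)
    case 0
    show ?case
      by (auto simp: walk2_init_def fun_eq_iff R_def L_def r_def l_def E_def K0 split: nat.split)
  next
    case (Suc t)
    have R1: "fps_nth (R (Suc 0)) (Suc t) = g * fps_nth (L 0) t"
    proof -
      have "L 0 = E * K" by (simp add: L_def l_def algebra_simps)
      then show ?thesis by (simp add: R_def r_def)
    qed
    have R2: "fps_nth (R (Suc (Suc x))) (Suc t) = cRR * fps_nth (R (Suc x)) t + cRL * fps_nth (L (Suc x)) t" for x
    proof -
      have "R (Suc (Suc x)) = (r * q) * q ^ x" by (simp add: R_def mult_ac)
      also have "\<dots> = fps_X * (fps_const cRR * R (Suc x) + fps_const cRL * L (Suc x))"
        unfolding e2 by (simp add: R_def L_def algebra_simps)
      finally show ?thesis by simp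
    qed
    have L1: "fps_nth (L x) (Suc t) = cLR * fps_nth (R (Suc x)) t + cLL * fps_nth (L (Suc x)) t" for x
    proof -
      \<comment> \<open>The separated term \<open>E\<close> is constant and so has no coefficient at
        \<open>Suc t\<close>.\<close>
      have "fps_nth (L x) (Suc t) = fps_nth (l * q ^ x) (Suc t)"
        by (simp add: L_def E_def)
      also have "l * q ^ x = fps_X * (fps_const cLR * R (Suc x) + fps_const cLL * L (Suc x))"
        by (subst e1) (simp add: R_def L_def algebra_simps)
      finally show ?thesis by simp
    qed
    have "(if y = 0 then 0 else if y = 1 then g * fps_nth (L 0) t
           else cRR * fps_nth (R (y - 1)) t + cRL * fps_nth (L (y - 1)) t) = fps_nth (R y) (Suc t)" for y
    proof (cases y)
      case 0
      then show ?thesis by (simp add: R_def)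
    next
      case (Suc x)
      then show ?thesis using R1 R2 by (cases x) auto
    qed
    moreover have "(walk2_step cRR cLR cRL cLL \<gamma> ^^ Suc t) (walk2_init \<delta>) =
        walk2_step cRR cLR cRL cLL \<gamma> ((\<lambda>x. fps_nth (R x) t), (\<lambda>x. fps_nth (L x) t))"
      by (simp add: Suc)
    ultimately show ?case
      unfolding walk2_step_def[of _ _ _ _ _ "(_, _)"] fst_conv snd_conv
      using L1 by (simp only: g_def[symmetric] Suc_eq_plus1[symmetric])
  qed
  then show ?thesis by (simp add: L_def l_def E_def algebra_simps)
qed

section \<open>Propagation of the asymptotics from the origin\<close>

text \<open>By \<open>eig\<close> the limiting profile obeys the same recursions as the walk, hence
  so do the errors. Dividing by \<open>cLL\<close> carries the error of \<open>L\<close> one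
  position outwards, and \<open>R2\<close> then carries that of \<open>R\<close>. The parity factor
  comes from averaging the profiles for \<open>\<omega>\<close> and
  \<open>- \<omega>\<close>.\<close>

lemma walk_asymp_propagates:
  fixes L R :: "nat \<Rightarrow> nat \<Rightarrow> complex"
  assumes R1: "\<And>t. R (Suc t) (Suc 0) = g * L t 0"
    and R2: "\<And>t x. R (Suc t) (Suc (Suc x)) = cRR * R t (Suc x) + cRL * L t (Suc x)"
    and L1: "\<And>t x. L (Suc t) x = cLR * R t (Suc x) + cLL * L t (Suc x)"
    and nz: "cLL \<noteq> 0" "\<omega> \<noteq> 0"
    and eig: "g * \<eta> = cRR * (g / \<omega>) + cRL * \<eta>" "\<omega> = cLR * (g / \<omega>) + cLL * \<eta>"
    and L0: "(\<lambda>t. L t 0 - (1 + (-1) ^ t) / 2 * a * \<omega> ^ t) \<longlonglongrightarrow> 0"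
  shows "(\<lambda>t. L t x - (1 + (-1) ^ (x + t)) / 2 * a * \<eta> ^ x * \<omega> ^ t) \<longlonglongrightarrow> 0 \<and>
    (\<lambda>t. R t (Suc x) - (1 + (-1) ^ (Suc x + t)) / 2 * (a * (g / \<omega>)) * \<eta> ^ x * \<omega> ^ t) \<longlonglongrightarrow> 0"
proof (induction x)
  case 0
  have "(\<lambda>t. g * (L t 0 - (1 + (-1) ^ t) / 2 * a * \<omega> ^ t)) \<longlonglongrightarrow> 0"
    using tendsto_mult_left[OF L0, of g] by simp
  moreover have "g * (L t 0 - (1 + (-1) ^ t) / 2 * a * \<omega> ^ t) =
      R (Suc t) (Suc 0) - (1 + (-1) ^ (Suc 0 + Suc t)) / 2 * (a * (g / \<omega>)) * \<eta> ^ 0 * \<omega> ^ Suc t" for t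
    using nz(2) by (simp add: R1 field_simps)
  ultimately have "(\<lambda>t. R (Suc t) (Suc 0) - (1 + (-1) ^ (Suc 0 + Suc t)) / 2 * (a * (g / \<omega>)) * \<eta> ^ 0 * \<omega> ^ Suc t) \<longlonglongrightarrow> 0"
    by simp
  then have "(\<lambda>t. R t (Suc 0) - (1 + (-1) ^ (Suc 0 + t)) / 2 * (a * (g / \<omega>)) * \<eta> ^ 0 * \<omega> ^ t) \<longlonglongrightarrow> 0"
    by (rule LIMSEQ_imp_Suc)
  with L0 show ?case by simp
next
  case (Suc x)
  define e where "e t = (1 + (-1) ^ (Suc x + t)) / (2 :: complex)" for t
  define u where "u t = L t x - (1 + (-1) ^ (x + t)) / 2 * a * \<eta> ^ x * \<omega> ^ t" for t
  define v where "v t = R t (Suc x) - e t * (a * (g / \<omega>)) * \<eta> ^ x * \<omega> ^ t" for t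
  define w where "w t = L t (Suc x) - e t * a * \<eta> ^ Suc x * \<omega> ^ t" for t
  have u: "u \<longlonglongrightarrow> 0" and v: "v \<longlonglongrightarrow> 0"
    using Suc.IH unfolding u_def v_def e_def by auto
  \<comment> \<open>The recursion \<open>L1\<close> for the errors, solved for the one at the next
    position.\<close>
  have w: "w t = (u (Suc t) - cLR * v t) / cLL" for t
  proof -
    have "u (Suc t) = L (Suc t) x - e t * a * \<eta> ^ x * \<omega> ^ t * \<omega>"
      by (simp add: u_def e_def)
    also have "\<dots> = cLR * R t (Suc x) + cLL * L t (Suc x)
        - e t * a * \<eta> ^ x * \<omega> ^ t * (cLR * (g / \<omega>) + cLL * \<eta>)"
      unfolding L1 using eig(2) by simp
    also have "\<dots> = cLR * v t + cLL * w t"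
      by (simp add: v_def w_def algebra_simps)
    finally show ?thesis using nz(1) by simp
  qed
  have "(\<lambda>t. (u (Suc t) - cLR * v t) / cLL) \<longlonglongrightarrow> (0 - cLR * 0) / cLL"
    by (intro tendsto_intros v LIMSEQ_Suc[OF u] nz)
  then have wlim: "w \<longlonglongrightarrow> 0" by (simp add: w[abs_def])
  have "(\<lambda>t. cRR * v t + cRL * w t) \<longlonglongrightarrow> cRR * 0 + cRL * 0"
    by (intro tendsto_intros v wlim)
  moreover have "cRR * v t + cRL * w t = R (Suc t) (Suc (Suc x))
      - (1 + (-1) ^ (Suc (Suc x) + Suc t)) / 2 * (a * (g / \<omega>)) * \<eta> ^ Suc x * \<omega> ^ Suc t" for t
  proof -
    have "cRR * v t + cRL * w t = R (Suc t) (Suc (Suc x))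
        - e t * a * \<eta> ^ x * \<omega> ^ t * (cRR * (g / \<omega>) + cRL * \<eta>)"
      by (simp add: R2 v_def w_def algebra_simps)
    also have "cRR * (g / \<omega>) + cRL * \<eta> = \<omega> * (g / \<omega>) * \<eta>"
      using eig(1) nz(2) by simp
    finally show ?thesis by (simp add: e_def mult_ac)
  qed
  ultimately have "(\<lambda>t. R (Suc t) (Suc (Suc x))
      - (1 + (-1) ^ (Suc (Suc x) + Suc t)) / 2 * (a * (g / \<omega>)) * \<eta> ^ Suc x * \<omega> ^ Suc t) \<longlonglongrightarrow> 0"
    by simp
  from LIMSEQ_imp_Suc[OF this] wlim show ?case
    unfolding w_def[abs_def] e_def by simp
qed

section \<open>From amplitudes to probabilities\<close>

text \<open>Factor the difference of squares: \<open>|u| + |v| \<le> |u - v| + 2 B\<close> stays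
  bounded while the other factor vanishes.\<close>

lemma norm_square_diff_tendsto_0:
  fixes u v :: "nat \<Rightarrow> complex"
  assumes "(\<lambda>t. u t - v t) \<longlonglongrightarrow> 0" "\<And>t. cmod (v t) \<le> B"
  shows "(\<lambda>t. (cmod (u t))\<^sup>2 - (cmod (v t))\<^sup>2) \<longlonglongrightarrow> 0"
proof -
  have n: "(\<lambda>t. cmod (u t - v t)) \<longlonglongrightarrow> 0"
    using assms(1) by (simp add: tendsto_norm_zero)
  have "(\<lambda>t. cmod (u t - v t) * (cmod (u t - v t) + 2 * B)) \<longlonglongrightarrow> 0 * (0 + 2 * B)"
    by (intro tendsto_intros n)
  then have "(\<lambda>t. cmod (u t - v t) * (cmod (u t - v t) + 2 * B)) \<longlonglongrightarrow> 0" by simp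
  then show ?thesis
  proof (rule Lim_null_comparison[rotated], intro always_eventually allI)
    fix t
    have "norm ((cmod (u t))\<^sup>2 - (cmod (v t))\<^sup>2) = \<bar>cmod (u t) - cmod (v t)\<bar> * (cmod (u t) + cmod (v t))"
      by (simp add: abs_mult square_diff_square_factored power2_eq_square)
    also have "\<dots> \<le> cmod (u t - v t) * (cmod (u t - v t) + 2 * B)"
    proof (rule mult_mono)
      show "cmod (u t) + cmod (v t) \<le> cmod (u t - v t) + 2 * B"
        using assms(2)[of t] norm_triangle_ineq2[of "u t" "v t"] by linarith
    qed (auto intro: norm_triangle_ineq3)
    finally show "norm ((cmod (u t))\<^sup>2 - (cmod (v t))\<^sup>2) \<le> cmod (u t - v t) * (cmod (u t - v t) + 2 * B)" .
  qed
qed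

text \<open>The parity factor is 0 or 1, so it equals its own square.\<close>

lemma norm_square_asymp_parity:
  fixes u :: "nat \<Rightarrow> complex"
  assumes "(\<lambda>t. u t - (1 + (-1) ^ (n + t)) / 2 * c * d * \<omega> ^ t) \<longlonglongrightarrow> 0" "cmod \<omega> = 1"
  shows "(\<lambda>t. (cmod (u t))\<^sup>2 - (1 + (-1) ^ (n + t)) / 2 * (cmod (c * d))\<^sup>2) \<longlonglongrightarrow> 0"
proof -
  have eq: "(cmod ((1 + (-1) ^ (n + t)) / 2 * c * d * \<omega> ^ t))\<^sup>2 = (1 + (-1) ^ (n + t)) / 2 * (cmod (c * d))\<^sup>2" for t
    using assms(2) by (cases "even (n + t)") (simp_all add: norm_mult norm_power)
  have "cmod ((1 + (-1) ^ (n + t)) / 2 * c * d * \<omega> ^ t) \<le> cmod (c * d)" for t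
    using assms(2) by (cases "even (n + t)") (simp_all add: norm_mult norm_power)
  from norm_square_diff_tendsto_0[OF assms(1) this] show ?thesis
    by (simp only: eq)
qed

section \<open>The limit of the position probabilities\<close>

theorem theorem2:
  fixes cRR cLR cRL cLL :: complex and \<gamma> \<delta> :: real and x :: nat
  assumes "unitary2 cRR cLR cRL cLL"
    and "cRR \<noteq> 0"
  defines "b \<equiv> cnj cLR * coin_det cRR cLR cRL cLL * exp (- \<i> * of_real \<gamma>)"
  shows "(\<lambda>t. walk2_prob cRR cLR cRL cLL \<gamma> \<delta> t x
            - (1 + (-1) ^ (x + t)) / 2 *
              (if x = 0 then \<bar>M_of b\<bar>\<^sup>2
               else \<bar>M_of b\<bar>\<^sup>2 * (1 + 1 / (nu2 b)\<^sup>2) * (nu2 b) ^ (2 * x)))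
         \<longlonglongrightarrow> 0"
proof -
  define \<Delta> where "\<Delta> = coin_det cRR cLR cRL cLL"
  define g where "g = exp (\<i> * of_real \<gamma>)"
  define p where "p = (cmod b)\<^sup>2 + Re b"
  note U = unitary2_relations[OF assms(1), folded \<Delta>_def]
  have ng: "cmod g = 1" by (simp add: g_def)
  have gg: "g * cnj g = 1" using ng by (simp flip: complex_norm_square)
  have \<Delta>\<Delta>: "\<Delta> * cnj \<Delta> = 1" using U(3) by (simp flip: complex_norm_square)
  have bg: "b = cnj cLR * \<Delta> * cnj g"
    by (simp add: b_def \<Delta>_def g_def exp_cnj)
  have nb: "cmod b = cmod cLR" using U(3) ng by (simp add: bg norm_mult)
  have rho: "rho_of b = cmod cRR"
    \<comment> \<open>Thus \<open>cRR \<noteq> 0\<close> says exactly that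
      \<open>|b| < 1\<close>.\<close>
    using U(4) by (simp add: rho_of_def nb real_sqrt_unique flip: U(4))
  have "(cmod cRR)\<^sup>2 > 0" using assms(2) by simp
  then have "(cmod b)\<^sup>2 < 1" unfolding nb using U(4) by linarith
  then have b1: "cmod b < 1" by (simp add: power_less_one_iff)
  have bnz: "1 + b \<noteq> 0" using b1 by (metis add_eq_0_iff norm_minus_cancel norm_one less_irrefl)
  have cLL: "cLL \<noteq> 0" using U(2,3) assms(2) by auto
  have coin1: "cLR * g = \<Delta> * cnj b"
    using \<Delta>\<Delta> by (simp add: bg mult_ac)
  have coin2: "cRL = - b * g"
    using gg by (simp add: bg U(1) mult_ac)
  have coin3: "cLL * cRR = \<Delta> * (1 - b * cnj b)"
  proof -
    have "b * cnj b = of_real ((cmod cLR)\<^sup>2)" by (simp only: complex_norm_square[symmetric] nb)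
    moreover have "cRR * cnj cRR = of_real ((cmod cRR)\<^sup>2)" by (simp only: complex_norm_square)
    moreover have "(cmod cRR)\<^sup>2 = 1 - (cmod cLR)\<^sup>2" using U(4) by simp
    ultimately show ?thesis by (simp add: U(2) mult_ac)
  qed
  \<comment> \<open>Either square root serves, since \<omega> and its negative enter symmetrically.
    The value of \<open>\<eta>\<close> solves \<open>eig1\<close>, which by
    \<open>cRL = - b g\<close> reads \<open>(1 + b) \<eta> = cRR / \<omega>\<close>.\<close>
  define \<omega> where "\<omega> = csqrt (\<Delta> * (1 + cnj b) / (1 + b))"
  define \<eta> where "\<eta> = cRR / (\<omega> * (1 + b))"
  have \<omega>2: "\<omega>\<^sup>2 = \<Delta> * (1 + cnj b) / (1 + b)" by (simp add: \<omega>_def)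
  have "cmod (1 + cnj b) = cmod (1 + b)"
    by (metis complex_cnj_add complex_cnj_one complex_mod_cnj)
  then have n\<omega>: "cmod \<omega> = 1"
    using U(3) bnz by (simp add: \<omega>_def norm_csqrt norm_divide norm_mult)
  then have \<omega>nz: "\<omega> \<noteq> 0" by auto
  have n\<eta>: "cmod \<eta> = nu2 b"
    by (simp add: \<eta>_def nu2_def rho norm_divide norm_mult n\<omega>)
  have nu: "nu2 b \<noteq> 0" using assms(2) bnz by (simp add: nu2_def rho)
  have eig1: "g * \<eta> = cRR * (g / \<omega>) + cRL * \<eta>"
  proof -
    have "g * \<eta> - cRL * \<eta> = g * ((1 + b) * \<eta>)" by (simp add: coin2 algebra_simps)
    also have "(1 + b) * \<eta> = cRR / \<omega>" using bnz by (simp add: \<eta>_def)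
    finally show ?thesis by (simp add: algebra_simps)
  qed
  \<comment> \<open>Multiplied by \<open>\<omega> (1 + b)\<close>, this is the defining equation of
    \<open>\<omega>^2\<close>, because
    \<open>cnj b (1 + b) + (1 - b cnj b) = 1 + cnj b\<close>.\<close>
  have eig2: "\<omega> = cLR * (g / \<omega>) + cLL * \<eta>"
  proof -
    have "(cLR * (g / \<omega>) + cLL * \<eta>) * (\<omega> * (1 + b)) = cLR * g * (1 + b) + cLL * cRR"
      using bnz \<omega>nz by (simp add: \<eta>_def distrib_right)
    also have "\<dots> = \<Delta> * (1 + cnj b)" by (simp add: coin1 coin3 algebra_simps)
    also have "\<dots> = \<omega>\<^sup>2 * (1 + b)" using bnz by (simp add: \<omega>2)
    also have "\<dots> = \<omega> * (\<omega> * (1 + b))" by (simp add: power2_eq_square)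
    finally show ?thesis using bnz \<omega>nz by simp
  qed
  define L where "L t y = snd ((walk2_step cRR cLR cRL cLL \<gamma> ^^ t) (walk2_init \<delta>)) y" for t y
  define R where "R t y = fst ((walk2_step cRR cLR cRL cLL \<gamma> ^^ t) (walk2_init \<delta>)) y" for t y
  define a where "a = exp (\<i> * of_real \<delta>) * of_real ((p + \<bar>p\<bar>) / (cmod (1 + b))\<^sup>2)"
  have na: "cmod a = M_of b"
  proof -
    have "cmod a = (p + \<bar>p\<bar>) / (cmod (1 + b))\<^sup>2"
    proof -
      have "0 \<le> (p + \<bar>p\<bar>) / (cmod (1 + b))\<^sup>2"
        by (intro divide_nonneg_nonneg) auto
      then show ?thesis
        by (simp only: a_def norm_mult norm_exp_i_times norm_of_real abs_of_nonneg mult_1_left)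
    qed
    \<comment> \<open>This identity is the source of the sign factor in \<open>M_of\<close>.\<close>
    also have "p + \<bar>p\<bar> = (1 + sgn p) * \<bar>p\<bar>"
      by (simp add: sgn_real_def abs_if)
    finally show ?thesis
      by (simp add: M_of_def norm_divide norm_power p_def del: of_real_add)
  qed
  obtain K where K: "fps_nth K 0 = 1"
    "K\<^sup>2 * (fps_const (1 + b) - fps_const \<Delta> * fps_X\<^sup>2 * fps_const (1 + cnj b))
       - K * (fps_const (2 * b + 1) - fps_const \<Delta> * fps_X\<^sup>2) + fps_const b = 0"
    "(\<lambda>n. fps_nth K n - (1 + (-1) ^ n) / 2 * of_real ((p + \<bar>p\<bar>) / (cmod (1 + b))\<^sup>2) * \<omega> ^ n) \<longlonglongrightarrow> 0"
    using origin_fps[OF b1 U(3) \<omega>2] unfolding p_def by blast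
  have L0: "L t 0 = exp (\<i> * of_real \<delta>) * fps_nth K t" for t
    unfolding L_def by (rule walk2_amplitude_origin[OF _ coin2[unfolded g_def] coin3 K(1,2)])
       (use coin1 in \<open>simp add: g_def\<close>)
  have "(\<lambda>t. L t 0 - (1 + (-1) ^ t) / 2 * a * \<omega> ^ t) \<longlonglongrightarrow> 0"
    using tendsto_mult_left[OF K(3), of "exp (\<i> * of_real \<delta>)"]
    by (simp add: L0 a_def right_diff_distrib mult_ac)
  then have asymp: "(\<lambda>t. L t y - (1 + (-1) ^ (y + t)) / 2 * a * \<eta> ^ y * \<omega> ^ t) \<longlonglongrightarrow> 0 \<and>
    (\<lambda>t. R t (Suc y) - (1 + (-1) ^ (Suc y + t)) / 2 * (a * (g / \<omega>)) * \<eta> ^ y * \<omega> ^ t) \<longlonglongrightarrow> 0" for y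
    by (intro walk_asymp_propagates[OF _ _ _ cLL \<omega>nz eig1 eig2])
       (simp_all add: L_def R_def walk2_step_def g_def)
  have Lx: "(\<lambda>t. (cmod (L t y))\<^sup>2 - (1 + (-1) ^ (y + t)) / 2 * ((M_of b)\<^sup>2 * nu2 b ^ (2 * y))) \<longlonglongrightarrow> 0" for y
    using norm_square_asymp_parity[OF conjunct1[OF asymp] n\<omega>, of y]
    by (simp add: norm_mult norm_power na n\<eta> power_mult_distrib power_even_eq)
  have Rx: "(\<lambda>t. (cmod (R t (Suc y)))\<^sup>2 - (1 + (-1) ^ (Suc y + t)) / 2 * ((M_of b)\<^sup>2 * nu2 b ^ (2 * y))) \<longlonglongrightarrow> 0" for y
    using norm_square_asymp_parity[OF conjunct2[OF asymp] n\<omega>, of y]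
    by (simp add: norm_mult norm_divide norm_power na n\<eta> ng n\<omega> power_mult_distrib power_even_eq)
  show ?thesis
  proof (cases x)
    case 0
    then show ?thesis using Lx[of 0] by (simp add: walk2_prob_def L_def Let_def)
  next
    case (Suc y)
    \<comment> \<open>The \<open>R\<close> amplitude at \<open>x = Suc y\<close> carries the
      exponent \<open>2 y\<close>, one step behind the \<open>L\<close> amplitude; this lag is the
      summand \<open>1 / (nu2 b)^2\<close>.\<close>
    have "(M_of b)\<^sup>2 * (1 + 1 / (nu2 b)\<^sup>2) * nu2 b ^ (2 * x)
        = (M_of b)\<^sup>2 * nu2 b ^ (2 * y) + (M_of b)\<^sup>2 * nu2 b ^ (2 * x)"
      using nu by (simp add: Suc field_simps power2_eq_square)
    then have "walk2_prob cRR cLR cRL cLL \<gamma> \<delta> t x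
            - (1 + (-1) ^ (x + t)) / 2 *
              (if x = 0 then \<bar>M_of b\<bar>\<^sup>2
               else \<bar>M_of b\<bar>\<^sup>2 * (1 + 1 / (nu2 b)\<^sup>2) * (nu2 b) ^ (2 * x))
      = ((cmod (R t (Suc y)))\<^sup>2 - (1 + (-1) ^ (Suc y + t)) / 2 * ((M_of b)\<^sup>2 * nu2 b ^ (2 * y)))
       + ((cmod (L t x))\<^sup>2 - (1 + (-1) ^ (x + t)) / 2 * ((M_of b)\<^sup>2 * nu2 b ^ (2 * x)))" for t
      by (simp add: walk2_prob_def L_def R_def Let_def Suc algebra_simps)
    then show ?thesis using tendsto_add[OF Rx[of y] Lx[of x]] by simp
  qed
qed

end
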